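(* Let $\phi:\mathbb R^n\to\mathbb R^q$, let $\phi(\bar z)\le0$, and suppose that $\phi$ is directionally Lipschitz continuous and directionally differentiable at $\bar z$ in direction $u\in L(\bar z)$. If the directional quasi-normality holds at $\bar z$ in direction $u$ for the inequality system $\phi(z)\le0$, then the system $\phi(z)\le0$ satisfies the directional metric subregularity constraint qualification (MSCQ) at $\bar z$ in direction $u$.
   Context: $\mathbb B$ is the open unit ball. For a direction $d$ and $\epsilon,\delta>0$: $\mathcal V_{\epsilon,\delta}(d):=\{z\in\epsilon\mathbb B : \big\|\,\|d\|z-\|z\|d\,\big\|\le\delta\|z\|\|d\|\}$. $\phi'(z;u):=\lim_{t\downarrow0}(\phi(z+tu)-\phi(z))/t$; $\phi$ is directionally differentiable at $z$ in direction $u$ if this limit exists. $\phi$ is directionally Lipschitz continuous at $\bar z$ in direction $u$ if there are $L,\epsilon,\delta>0$ with $\|\phi(z)-\phi(z')\|\le L\|z-z'\|$ for all $z,z'\in\bar z+\mathcal V_{\epsilon,\delta}(u)$. $I_\phi(\bar z)=\{j:\phi_j(\bar z)=0\}$; $u\in L(\bar z)$ (linearized cone) means $\phi_j'(\bar z;u)\le0$ for all $j\in I_\phi(\bar z)$. Regular subdifferential: $\widehat\partial\psi(\bar z)=\{\xi:\psi(z)\ge\psi(\bar z)+\langle\xi,z-\bar z\rangle+o(\|z-\bar z\|)\}$. Directional limiting subdifferential: $\partial\psi(\bar z;u)=\{\xi:\exists t_k\downarrow0,u^k\to u,\xi^k\to\xi\text{ with }\psi(\bar z+t_ku^k)\to\psi(\bar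 z),\ \xi^k\in\widehat\partial\psi(\bar z+t_ku^k)\}$. Directional quasi-normality at $\bar z$ in direction $u$: there exists no $\zeta\in\mathbb R^q$, $\zeta\ne0$, satisfying $\zeta\ge0$, $\zeta\perp\phi(\bar z)$, $\zeta\perp\phi'(\bar z;u)$, $0\in\partial\langle\zeta,\phi\rangle(\bar z;u)$, and for which there exist sequences $t_k\downarrow0$, $u^k\to u$ with $\phi_j(\bar z+t_ku^k)>0$ (for all $k$) whenever $j\in I_\phi(\bar z)$ and $\zeta_j>0$. Directional MSCQ at $\bar z$ in direction $u$: there are $\epsilon,\delta,\kappa>0$ with $\mathrm{dist}(z,\phi^{-1}(\mathbb R^q_-))\le\kappa\|\phi_+(z)\|$ for all $z\in\bar z+\mathcal V_{\epsilon,\delta}(u)$, where $\phi_+(z)=\max\{0,\phi(z)\}$ componentwise and $\phi^{-1}(\mathbb R^q_-)=\{z:\phi(z)\le0\}$. *)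

theory Defs
  imports "HOL-Analysis.Analysis" "HOL-Library.Landau_Symbols"
begin

definition dir_nbhd :: "real \<Rightarrow> real \<Rightarrow> 'a::real_normed_vector \<Rightarrow> 'a set"
  where "dir_nbhd \<epsilon> \<delta> d =
    {z \<in> ball 0 \<epsilon>. norm (norm d *\<^sub>R z - norm z *\<^sub>R d) \<le> \<delta> * norm z * norm d}"

definition dir_differentiable ::
    "('a::real_normed_vector \<Rightarrow> 'b::real_normed_vector) \<Rightarrow> 'a \<Rightarrow> 'a \<Rightarrow> bool"
  where "dir_differentiable \<phi> z u \<longleftrightarrow>
    (\<exists>l. ((\<lambda>t. (\<phi> (z + t *\<^sub>R u) - \<phi> z) /\<^sub>R t) \<longlongrightarrow> l) (at_right 0))"

text \<open>Meaningful only when \<open>dir_differentiable \<phi> z u\<close> holds; otherwise an unspecified value.\<close>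
definition dir_deriv ::
    "('a::real_normed_vector \<Rightarrow> 'b::real_normed_vector) \<Rightarrow> 'a \<Rightarrow> 'a \<Rightarrow> 'b"
  where "dir_deriv \<phi> z u = Lim (at_right 0) (\<lambda>t. (\<phi> (z + t *\<^sub>R u) - \<phi> z) /\<^sub>R t)"

definition dir_lipschitz ::
    "('a::real_normed_vector \<Rightarrow> 'b::real_normed_vector) \<Rightarrow> 'a \<Rightarrow> 'a \<Rightarrow> bool"
  where "dir_lipschitz \<phi> zbar u \<longleftrightarrow>
    (\<exists>L>0. \<exists>\<epsilon>>0. \<exists>\<delta>>0. \<forall>z \<in> (+) zbar ` dir_nbhd \<epsilon> \<delta> u. \<forall>z' \<in> (+) zbar ` dir_nbhd \<epsilon> \<delta> u.
       norm (\<phi> z - \<phi> z') \<le> L * norm (z - z'))"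

definition active_set :: "('a \<Rightarrow> real ^ 'q) \<Rightarrow> 'a \<Rightarrow> 'q set"
  where "active_set \<phi> zbar = {j. \<phi> zbar $ j = 0}"

definition linearized_cone :: "('a::real_normed_vector \<Rightarrow> real ^ 'q) \<Rightarrow> 'a \<Rightarrow> 'a set"
  where "linearized_cone \<phi> zbar =
    {u. \<forall>j \<in> active_set \<phi> zbar.
       dir_differentiable (\<lambda>z. \<phi> z $ j) zbar u \<and> dir_deriv (\<lambda>z. \<phi> z $ j) zbar u \<le> 0}"

definition regular_subdiff :: "('a::real_inner \<Rightarrow> real) \<Rightarrow> 'a \<Rightarrow> 'a set"
  where "regular_subdiff \<psi> zbar =
    {\<xi>. \<exists>r \<in> o[at zbar](\<lambda>z. norm (z - zbar)).
       \<forall>\<^sub>F z in at zbar. \<psi> z \<ge> \<psi> zbar + \<xi> \<bullet> (z - zbar) + r z}"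

definition dir_limiting_subdiff :: "('a::real_inner \<Rightarrow> real) \<Rightarrow> 'a \<Rightarrow> 'a \<Rightarrow> 'a set"
  where "dir_limiting_subdiff \<psi> zbar u =
    {\<xi>. \<exists>(t :: nat \<Rightarrow> real) (us :: nat \<Rightarrow> 'a) (\<xi>s :: nat \<Rightarrow> 'a).
       (\<forall>k. t k > 0) \<and> t \<longlonglongrightarrow> 0 \<and> us \<longlonglongrightarrow> u \<and> \<xi>s \<longlonglongrightarrow> \<xi> \<and>
       (\<lambda>k. \<psi> (zbar + t k *\<^sub>R us k)) \<longlonglongrightarrow> \<psi> zbar \<and>
       (\<forall>k. \<xi>s k \<in> regular_subdiff \<psi> (zbar + t k *\<^sub>R us k))}"

definition dir_quasi_normality :: "('a::real_inner \<Rightarrow> real ^ 'q) \<Rightarrow> 'a \<Rightarrow> 'a \<Rightarrow> bool"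
  where "dir_quasi_normality \<phi> zbar u \<longleftrightarrow>
    \<not> (\<exists>\<zeta>. \<zeta> \<noteq> 0 \<and> \<zeta> \<ge> 0 \<and> orthogonal \<zeta> (\<phi> zbar) \<and> orthogonal \<zeta> (dir_deriv \<phi> zbar u) \<and>
       0 \<in> dir_limiting_subdiff (\<lambda>z. \<zeta> \<bullet> \<phi> z) zbar u \<and>
       (\<exists>(t :: nat \<Rightarrow> real) (us :: nat \<Rightarrow> 'a).
          (\<forall>k. t k > 0) \<and> t \<longlonglongrightarrow> 0 \<and> us \<longlonglongrightarrow> u \<and>
          (\<forall>j \<in> active_set \<phi> zbar. \<zeta> $ j > 0 \<longrightarrow> (\<forall>k. \<phi> (zbar + t k *\<^sub>R us k) $ j > 0))))"

definition pos_part_vec :: "real ^ 'q \<Rightarrow> real ^ 'q"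
  where "pos_part_vec y = (\<chi> j. max 0 (y $ j))"

text \<open>The order on \<^typ>\<open>real ^ 'q\<close> is componentwise. \<^const>\<open>infdist\<close> to the empty set is \<open>0\<close>
  rather than infinite, so this is the intended notion only when \<open>\<phi> z \<le> 0\<close> is solvable.\<close>
definition dir_MSCQ :: "('a::real_normed_vector \<Rightarrow> real ^ 'q) \<Rightarrow> 'a \<Rightarrow> 'a \<Rightarrow> bool"
  where "dir_MSCQ \<phi> zbar u \<longleftrightarrow>
    (\<exists>\<epsilon>>0. \<exists>\<delta>>0. \<exists>\<kappa>>0. \<forall>z \<in> (+) zbar ` dir_nbhd \<epsilon> \<delta> u.
       infdist z {x. \<phi> x \<le> 0} \<le> \<kappa> * norm (pos_part_vec (\<phi> z)))"

end

theory Submission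
  imports Defs
begin

text \<open>If directional MSCQ fails, there are points \<open>z\<close> converging to \<open>zbar\<close> in direction \<open>u\<close> whose distance \<open>d\<close>
  to the feasible set is large compared with \<open>\<parallel>\<phi>\<^sub>+(z)\<parallel>\<close>. Minimising \<open>\<parallel>\<phi>\<^sub>+\<parallel>\<close> plus a small multiple of the
  distance to \<open>z\<close> over a ball of radius much smaller than \<open>d\<close> gives an infeasible interior minimiser
  \<open>w\<close>. Since \<open>\<parallel>\<cdot>\<^sub>+\<parallel>\<close> is differentiable off the nonpositive orthant, \<open>w\<close> is almost stationary for
  \<open>\<langle>\<zeta>, \<phi>\<rangle>\<close>, where \<open>\<zeta>\<close> is the normalised \<open>\<phi>\<^sub>+(w)\<close>. A limit of these unit multipliers violates
  quasi-normality: replacing \<open>\<zeta>\<close> by the limit costs only a small Lipschitz error, and a second,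
  quadratic penalisation turns almost stationarity into a small regular subgradient at a nearby
  point.\<close>

section \<open>Sectors and directional neighbourhoods\<close>

text \<open>Unlike \<^const>\<open>dir_nbhd\<close>, the sector omits the apex and is open, so it contains small balls around
  each of its points; this also covers the case \<open>u = 0\<close> uniformly.\<close>
definition dir_sector :: "real \<Rightarrow> 'a::real_normed_vector \<Rightarrow> 'a set"
  where "dir_sector \<eta> u = {t *\<^sub>R v | t v. 0 < t \<and> t < \<eta> \<and> dist v u < \<eta>}"

lemma dir_sectorI: "0 < t \<Longrightarrow> t < \<eta> \<Longrightarrow> dist v u < \<eta> \<Longrightarrow> t *\<^sub>R v \<in> dir_sector \<eta> u"
  unfolding dir_sector_def by blast

text \<open>For \<open>z = t *\<^sub>R v\<close> the vector in the angular condition has norm at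
  most \<open>2 * t * \<eta> * norm u\<close>, while the bound allowed is at least
  \<open>\<delta> * t * (norm u - \<eta>) * norm u\<close>. For \<open>u = 0\<close> both sides
  vanish.\<close>

lemma dir_sector_subset_dir_nbhd:
  fixes u :: "'a::real_normed_vector"
  assumes "\<epsilon> > 0" "\<delta> > 0"
  obtains \<eta> where "\<eta> > 0" "dir_sector \<eta> u \<subseteq> dir_nbhd \<epsilon> \<delta> u"
proof -
  obtain \<eta> where \<eta>: "\<eta> > 0" "\<eta> \<le> 1" "\<eta> * (norm u + 1) \<le> \<epsilon>"
    and \<eta>u: "u \<noteq> 0 \<Longrightarrow> (2 + \<delta>) * \<eta> \<le> \<delta> * norm u"
  proof
    \<comment> \<open>The last entry solves
      \<open>2 * \<eta> \<le> \<delta> * (norm u - \<eta>)\<close> for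
      \<open>\<eta>\<close>.\<close>
    let ?\<eta> = "min (min 1 (\<epsilon> / (norm u + 1))) (if u = 0 then 1 else \<delta> * norm u / (2 + \<delta>))"
    have pos: "norm u + 1 > 0" by (simp add: add_nonneg_pos)
    show "?\<eta> > 0" "?\<eta> \<le> 1" using assms pos by auto
    show "?\<eta> * (norm u + 1) \<le> \<epsilon>"
      using pos by (subst pos_le_divide_eq[symmetric]) auto
    show "(2 + \<delta>) * ?\<eta> \<le> \<delta> * norm u" if "u \<noteq> 0"
      using that assms
      by (subst mult.commute, subst pos_le_divide_eq[symmetric]) auto
  qed
  have "t *\<^sub>R v \<in> dir_nbhd \<epsilon> \<delta> u" if t: "0 < t" "t < \<eta>" and v: "dist v u < \<eta>" for t v
  proof -
    have nv: "norm v \<le> norm u + \<eta>" "norm u - \<eta> \<le> norm v"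
      using v norm_triangle_ineq2[of v u] norm_triangle_ineq2[of u v]
      by (auto simp: dist_norm norm_minus_commute)
    have "t * norm v \<le> t * (norm u + 1)" using t nv \<eta> by (intro mult_left_mono) auto
    also have "\<dots> < \<eta> * (norm u + 1)"
      using t by (intro mult_strict_right_mono) (auto intro: add_nonneg_pos)
    finally have "t * norm v < \<eta> * (norm u + 1)" .
    then have 1: "norm (t *\<^sub>R v) < \<epsilon>" using t \<eta> by simp
    have "norm (norm u *\<^sub>R t *\<^sub>R v - norm (t *\<^sub>R v) *\<^sub>R u)
        = norm (t *\<^sub>R (norm u *\<^sub>R (v - u) + (norm u - norm v) *\<^sub>R u))"
      using t by (simp add: algebra_simps)
    also have "\<dots> = t * norm (norm u *\<^sub>R (v - u) + (norm u - norm v) *\<^sub>R u)"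
      using t by simp
    also have "\<dots> \<le> t * (norm u * norm (v - u) + \<bar>norm u - norm v\<bar> * norm u)"
      using t by (intro mult_left_mono order_trans[OF norm_triangle_ineq]) auto
    also have "\<dots> \<le> t * (norm u * \<eta> + \<eta> * norm u)"
      using t v nv
      by (intro mult_left_mono add_mono mult_right_mono) (auto simp: dist_norm)
    also have "\<dots> \<le> \<delta> * norm (t *\<^sub>R v) * norm u"
    proof (cases "u = 0")
      case False
      have "\<delta> * (norm u - \<eta>) \<le> \<delta> * norm v" using nv assms by (intro mult_left_mono) auto
      then have "2 * \<eta> \<le> \<delta> * norm v" using \<eta>u[OF False] by (simp add: algebra_simps)
      then have "t * norm u * (2 * \<eta>) \<le> t * norm u * (\<delta> * norm v)"
        using t by (intro mult_left_mono) auto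
      then show ?thesis using t by (simp add: algebra_simps)
    qed simp
    finally show ?thesis using 1 by (simp add: dir_nbhd_def)
  qed
  then show ?thesis using that[OF \<eta>(1)] by (auto simp: dir_sector_def)
qed

text \<open>For \<open>u \<noteq> 0\<close>, scaling by \<open>t = norm z / norm u\<close> turns the
  angular condition into a bound on the distance from \<open>inverse t *\<^sub>R z\<close> to
  \<open>u\<close>. For \<open>u = 0\<close> the neighbourhood is a ball, and every short vector is
  a fixed multiple of a vector near \<open>0\<close>. The apex need not lie in the sector.\<close>

lemma dir_nbhd_subset_dir_sector:
  fixes u :: "'a::real_normed_vector"
  assumes "\<eta> > 0"
  obtains \<epsilon> \<delta> where "\<epsilon> > 0" "\<delta> > 0" "dir_nbhd \<epsilon> \<delta> u \<subseteq> insert 0 (dir_sector \<eta> u)"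
proof (cases "u = 0")
  case True
  have "z \<in> dir_sector \<eta> u" if "z \<in> dir_nbhd (\<eta>\<^sup>2 / 2) 1 u" for z
  proof -
    have "norm z < \<eta>\<^sup>2 / 2" using that by (simp add: dir_nbhd_def)
    then have "(\<eta> / 2) *\<^sub>R ((2 / \<eta>) *\<^sub>R z) \<in> dir_sector \<eta> u"
      using assms True by (intro dir_sectorI) (auto simp: field_simps power2_eq_square)
    then show ?thesis using assms by simp
  qed
  then show ?thesis using that[of "\<eta>\<^sup>2 / 2" 1] assms by auto
next
  case False
  define \<delta> where "\<delta> = \<eta> / (2 * norm u)"
  have "\<delta> > 0" using assms False by (simp add: \<delta>_def)
  have "z \<in> dir_sector \<eta> u" if z: "z \<in> dir_nbhd (\<eta> * norm u) \<delta> u" "z \<noteq> 0" for z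
  proof -
    define t where "t = norm z / norm u"
    have t: "0 < t" "t < \<eta>"
      using z False by (auto simp: t_def dir_nbhd_def divide_simps)
    have zt: "norm z = t * norm u" using False by (simp add: t_def)
    have "norm u *\<^sub>R z - norm z *\<^sub>R u = (t * norm u) *\<^sub>R (inverse t *\<^sub>R z - u)"
      using t by (simp add: zt algebra_simps)
    then have "t * norm u * norm (inverse t *\<^sub>R z - u) \<le> \<delta> * norm z * norm u"
      using z t by (simp add: dir_nbhd_def)
    also have "\<dots> = t * norm u * (\<delta> * norm u)" by (simp add: zt)
    finally have "norm (inverse t *\<^sub>R z - u) \<le> \<delta> * norm u"
      using t False by (subst (asm) mult_le_cancel_left_pos) auto
    also have "\<dots> < \<eta>" using False assms by (simp add: \<delta>_def)
    finally have "t *\<^sub>R (inverse t *\<^sub>R z) \<in> dir_sector \<eta> u"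
      using t by (intro dir_sectorI) (auto simp: dist_norm)
    then show ?thesis using t by simp
  qed
  then show ?thesis using that[of "\<eta> * norm u" \<delta>] assms False \<open>\<delta> > 0\<close> by auto
qed

text \<open>With \<open>t\<close> fixed, moving the point by at most \<open>\<rho>\<close> moves its
  direction by at most \<open>\<rho> / t\<close>.\<close>

lemma cball_subset_dir_sector:
  fixes v :: "'a::real_normed_vector"
  assumes "0 < t" "t < \<eta>" "dist v u + \<rho> / t < \<eta>"
  shows "cball (x + t *\<^sub>R v) \<rho> \<subseteq> (+) x ` dir_sector \<eta> u"
proof
  fix y assume "y \<in> cball (x + t *\<^sub>R v) \<rho>"
  then have y: "norm (y - (x + t *\<^sub>R v)) \<le> \<rho>" by (simp add: dist_norm norm_minus_commute)
  define v' where "v' = v + inverse t *\<^sub>R (y - (x + t *\<^sub>R v))"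
  have "dist v' v \<le> \<rho> / t"
    using y assms(1) by (simp add: v'_def dist_norm divide_inverse mult.commute)
  then have "t *\<^sub>R v' \<in> dir_sector \<eta> u"
    using assms dist_triangle[of v' u v] by (intro dir_sectorI) auto
  moreover have "y = x + t *\<^sub>R v'" using assms(1) by (simp add: v'_def algebra_simps)
  ultimately show "y \<in> (+) x ` dir_sector \<eta> u" by blast
qed

section \<open>Lipschitz continuity and derivatives along directional sequences\<close>

lemma dir_lipschitz_imp_lipschitz_on_sector:
  assumes "dir_lipschitz \<phi> x u"
  obtains L \<eta> where "\<eta> > 0" "L-lipschitz_on (insert x ((+) x ` dir_sector \<eta> u)) \<phi>"
proof -
  from assms obtain L \<epsilon> \<delta> where L: "L > 0" "\<epsilon> > 0" "\<delta> > 0"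
    and lip: "\<forall>z \<in> (+) x ` dir_nbhd \<epsilon> \<delta> u. \<forall>z' \<in> (+) x ` dir_nbhd \<epsilon> \<delta> u.
       norm (\<phi> z - \<phi> z') \<le> L * norm (z - z')"
    unfolding dir_lipschitz_def by blast
  obtain \<eta> where \<eta>: "\<eta> > 0" "dir_sector \<eta> u \<subseteq> dir_nbhd \<epsilon> \<delta> u"
    using dir_sector_subset_dir_nbhd L by blast
  \<comment> \<open>The apex is kept so that values along directional sequences can be compared with
    the value at the base point.\<close>
  have "0 \<in> dir_nbhd \<epsilon> \<delta> u" using L by (simp add: dir_nbhd_def)
  then have "insert x ((+) x ` dir_sector \<eta> u) \<subseteq> (+) x ` dir_nbhd \<epsilon> \<delta> u"
    using \<eta> by (auto simp: image_iff intro!: bexI[of _ 0])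
  then have "L-lipschitz_on (insert x ((+) x ` dir_sector \<eta> u)) \<phi>"
    using lip L unfolding lipschitz_on_def dist_norm by (meson less_imp_le subsetD)
  with \<eta> that show ?thesis by blast
qed

lemma dir_sequence_eventually_in_sector:
  assumes "\<eta> > 0" "\<And>k. t k > 0" "t \<longlonglongrightarrow> 0" "us \<longlonglongrightarrow> u"
  shows "\<forall>\<^sub>F k in sequentially. x + t k *\<^sub>R us k \<in> (+) x ` dir_sector \<eta> u"
proof -
  have "\<forall>\<^sub>F k in sequentially. t k < \<eta>" using assms order_tendstoD(2) by blast
  moreover have "\<forall>\<^sub>F k in sequentially. dist (us k) u < \<eta>" using assms tendstoD by blast
  ultimately show ?thesis
    by eventually_elim (use assms dir_sectorI in blast)
qed

lemma dir_deriv_tendsto: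
  assumes "dir_differentiable \<phi> x u"
  shows "((\<lambda>t. (\<phi> (x + t *\<^sub>R u) - \<phi> x) /\<^sub>R t) \<longlongrightarrow> dir_deriv \<phi> x u) (at_right 0)"
  using assms tendsto_Lim[OF trivial_limit_at_right_real]
  unfolding dir_differentiable_def dir_deriv_def by fastforce

text \<open>The Lipschitz bound lets the direction vary: the quotients along \<open>us k\<close> and
  along the fixed \<open>u\<close> differ by at most \<open>L * norm (us k - u)\<close>.\<close>

lemma dir_deriv_Hadamard:
  assumes lip: "L-lipschitz_on (insert x ((+) x ` dir_sector \<eta> u)) \<phi>"
    and "\<eta> > 0" "dir_differentiable \<phi> x u"
    and t: "\<And>k. t k > 0" "t \<longlonglongrightarrow> 0" and us: "us \<longlonglongrightarrow> u"
  shows "(\<lambda>k. (\<phi> (x + t k *\<^sub>R us k) - \<phi> x) /\<^sub>R t k) \<longlonglongrightarrow> dir_deriv \<phi> x u"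
proof -
  have "filterlim t (at_right 0) sequentially"
    using t by (auto intro!: tendsto_imp_filterlim_at_right)
  from filterlim_compose[OF dir_deriv_tendsto[OF assms(3)] this]
  have lim: "(\<lambda>k. (\<phi> (x + t k *\<^sub>R u) - \<phi> x) /\<^sub>R t k) \<longlonglongrightarrow> dir_deriv \<phi> x u" .
  have "(\<lambda>k. (\<phi> (x + t k *\<^sub>R us k) - \<phi> x) /\<^sub>R t k - (\<phi> (x + t k *\<^sub>R u) - \<phi> x) /\<^sub>R t k) \<longlonglongrightarrow> 0"
  proof (rule Lim_null_comparison)
    show "(\<lambda>k. L * norm (us k - u)) \<longlonglongrightarrow> 0"
      using us by (intro tendsto_mult_right_zero tendsto_norm_zero) (simp add: LIM_zero)
    show "\<forall>\<^sub>F k in sequentially. norm ((\<phi> (x + t k *\<^sub>R us k) - \<phi> x) /\<^sub>R t k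
        - (\<phi> (x + t k *\<^sub>R u) - \<phi> x) /\<^sub>R t k) \<le> L * norm (us k - u)"
      using dir_sequence_eventually_in_sector[OF \<open>\<eta> > 0\<close> t us, of x]
        dir_sequence_eventually_in_sector[OF \<open>\<eta> > 0\<close> t tendsto_const[of u], of x]
    proof eventually_elim
      case (elim k)
      then have "norm (\<phi> (x + t k *\<^sub>R us k) - \<phi> (x + t k *\<^sub>R u)) \<le> L * (t k * norm (us k - u))"
        using lipschitz_onD[OF lip, of "x + t k *\<^sub>R us k" "x + t k *\<^sub>R u"] t(1)[of k]
        by (simp add: dist_norm flip: scaleR_diff_right)
      moreover have "(\<phi> (x + t k *\<^sub>R us k) - \<phi> x) /\<^sub>R t k - (\<phi> (x + t k *\<^sub>R u) - \<phi> x) /\<^sub>R t k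
          = (\<phi> (x + t k *\<^sub>R us k) - \<phi> (x + t k *\<^sub>R u)) /\<^sub>R t k"
        by (simp add: algebra_simps)
      ultimately show ?case using t(1)[of k] by (simp add: divide_simps mult_ac)
    qed
  qed
  from tendsto_add[OF this lim] show ?thesis by simp
qed

section \<open>Regular subgradients from almost minimality\<close>

text \<open>A minimiser of \<open>\<psi>\<close> plus a quadratic penalty centred at \<open>w\<close> carries minus the gradient of
  the penalty as a regular subgradient.\<close>
lemma regular_subgradient_near_almost_min:
  fixes \<psi> :: "'a::euclidean_space \<Rightarrow> real"
  assumes "\<rho> > 0" "e > 0" and cont: "continuous_on (cball w \<rho>) \<psi>"
    and lower: "\<And>z. z \<in> cball w \<rho> \<Longrightarrow> \<psi> z \<ge> \<psi> w - e * norm (z - w)"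
  obtains w' \<xi> where "dist w w' < \<rho>" "norm \<xi> \<le> 2 * e" "\<xi> \<in> regular_subdiff \<psi> w'"
proof -
  \<comment> \<open>Comparing the minimiser \<open>w'\<close> with \<open>w\<close> gives
    \<open>a * norm (w' - w) \<le> e\<close>; this value of \<open>a\<close> then places
    \<open>w'\<close> within \<open>\<rho> / 2\<close> of the centre, hence in the interior.\<close>
  define a where "a = 2 * e / \<rho>"
  have a: "a > 0" using assms by (simp add: a_def)
  have "continuous_on (cball w \<rho>) (\<lambda>z. \<psi> z + a * (norm (z - w))\<^sup>2)"
    by (intro continuous_intros cont)
  with assms(1) have "\<exists>w'\<in>cball w \<rho>. \<forall>z\<in>cball w \<rho>.
      \<psi> w' + a * (norm (w' - w))\<^sup>2 \<le> \<psi> z + a * (norm (z - w))\<^sup>2"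
    by (intro continuous_attains_inf) auto
  then obtain w' where w': "w' \<in> cball w \<rho>"
    and min: "\<And>z. z \<in> cball w \<rho> \<Longrightarrow> \<psi> w' + a * (norm (w' - w))\<^sup>2 \<le> \<psi> z + a * (norm (z - w))\<^sup>2"
    by blast
  have "a * norm (w' - w) * norm (w' - w) \<le> e * norm (w' - w)"
    using min[of w] lower[OF w'] assms(1) by (simp add: power2_eq_square)
  then have aw: "a * norm (w' - w) \<le> e"
    using assms(2) by (cases "w' = w") auto
  then have "norm (w' - w) \<le> \<rho> / 2"
    using assms by (simp add: a_def field_simps)
  then have near: "dist w w' < \<rho>"
    using assms(1) by (simp add: dist_norm norm_minus_commute)
  define \<xi> where "\<xi> = - (2 * a) *\<^sub>R (w' - w)"
  have "norm \<xi> \<le> 2 * e" using aw a by (simp add: \<xi>_def)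
  moreover have "\<xi> \<in> regular_subdiff \<psi> w'"
  proof -
    let ?r = "\<lambda>z. - a * (norm (z - w'))\<^sup>2"
    have "?r \<in> o[at w'](\<lambda>z. norm (z - w'))"
    proof (rule smalloI_tendsto)
      have "((\<lambda>z. - a * norm (z - w')) \<longlongrightarrow> - a * norm (w' - w')) (at w')"
        by (intro tendsto_intros)
      then have "((\<lambda>z. - a * norm (z - w')) \<longlongrightarrow> 0) (at w')" by simp
      then show "((\<lambda>z. ?r z / norm (z - w')) \<longlongrightarrow> 0) (at w')"
        by (rule Lim_transform_eventually) (simp add: eventually_at_filter power2_eq_square)
      show "\<forall>\<^sub>F z in at w'. norm (z - w') \<noteq> 0"
        by (simp add: eventually_at_filter)
    qed
    moreover have "\<forall>\<^sub>F z in at w'. z \<in> ball w \<rho>"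
      using near by (intro eventually_at_in_open') auto
    then have "\<forall>\<^sub>F z in at w'. \<psi> z \<ge> \<psi> w' + \<xi> \<bullet> (z - w') + ?r z"
    proof eventually_elim
      case (elim z)
      \<comment> \<open>Expanding the penalty around \<open>w'\<close> gives a linear part, which is
        \<open>\<xi>\<close> up to sign, and a quadratic part, which is the remainder.\<close>
      have "(norm (z - w))\<^sup>2 = (norm (z - w'))\<^sup>2 + 2 * ((w' - w) \<bullet> (z - w')) + (norm (w' - w))\<^sup>2"
        by (simp add: power2_norm_eq_inner algebra_simps inner_commute)
      then have "a * (norm (z - w))\<^sup>2
          = a * (norm (z - w'))\<^sup>2 - \<xi> \<bullet> (z - w') + a * (norm (w' - w))\<^sup>2"
        by (simp add: \<xi>_def distrib_left)
      then show ?case using min[of z] elim by simp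
    qed
    ultimately show ?thesis unfolding regular_subdiff_def by (intro CollectI bexI)
  qed
  ultimately show ?thesis using near that by blast
qed

section \<open>The norm of the positive part\<close>

lemma pos_part_vec_eq_0_iff: "pos_part_vec y = 0 \<longleftrightarrow> y \<le> 0"
  by (simp add: pos_part_vec_def vec_eq_iff less_eq_vec_def flip: max.absorb_iff1)

lemma continuous_on_pos_part_vec [continuous_intros]:
  "continuous_on S f \<Longrightarrow> continuous_on S (\<lambda>x. pos_part_vec (f x))"
  unfolding pos_part_vec_def by (intro continuous_intros) auto

text \<open>Here \<open>norm (pos_part_vec y)\<close> is the distance from \<open>y\<close> to the nonpositive orthant, whose gradient
  at an exterior point is the normalised positive part.\<close>
lemma norm_pos_part_vec_upper_expansion:
  fixes y y' :: "real ^ 'q"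
  assumes "pos_part_vec y \<noteq> 0"
  shows "norm (pos_part_vec y') \<le> norm (pos_part_vec y) + sgn (pos_part_vec y) \<bullet> (y' - y)
           + (norm (y' - y))\<^sup>2 / (2 * norm (pos_part_vec y))"
proof -
  define p h where "p = pos_part_vec y" and "h = y' - y"
  have p: "norm p > 0" using assms by (simp add: p_def)
  \<comment> \<open>As \<open>p\<close> dominates \<open>y\<close> and is nonnegative, a positive
    component of \<open>y'\<close> is at most that of \<open>p + h\<close>.\<close>
  have "norm (pos_part_vec y') \<le> norm (p + h)"
    by (rule norm_le_componentwise_cart) (auto simp: p_def h_def pos_part_vec_def)
  also have "\<dots> = sqrt ((norm p)\<^sup>2 + (2 * (p \<bullet> h) + (norm h)\<^sup>2))"
    unfolding norm_eq_sqrt_inner[of "p + h"]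
    by (simp add: power2_norm_eq_inner algebra_simps inner_commute)
  \<comment> \<open>This is the tangent bound for the concave square root at
    \<open>(norm p)\<^sup>2\<close>.\<close>
  also have "\<dots> \<le> norm p + (2 * (p \<bullet> h) + (norm h)\<^sup>2) / (2 * norm p)"
  proof (rule real_le_lsqrt)
    let ?b = "2 * (p \<bullet> h) + (norm h)\<^sup>2"
    have "(norm p + ?b / (2 * norm p))\<^sup>2 = (norm p)\<^sup>2 + ?b + (?b / (2 * norm p))\<^sup>2"
      using p by (simp add: power2_sum)
    then show "(norm p)\<^sup>2 + ?b \<le> (norm p + ?b / (2 * norm p))\<^sup>2" by simp
    have "0 \<le> (norm (p + h))\<^sup>2 + (norm p)\<^sup>2" by simp
    also have "\<dots> = 2 * (norm p)\<^sup>2 + ?b"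
      by (simp add: power2_norm_eq_inner algebra_simps inner_commute)
    finally have "0 \<le> (2 * (norm p)\<^sup>2 + ?b) / (2 * norm p)" using p by simp
    also have "\<dots> = norm p + ?b / (2 * norm p)"
      using p by (simp add: field_simps power2_eq_square)
    finally show "0 \<le> norm p + ?b / (2 * norm p)" .
  qed
  also have "\<dots> = norm p + sgn p \<bullet> h + (norm h)\<^sup>2 / (2 * norm p)"
    using p by (simp add: sgn_div_norm field_simps)
  finally show ?thesis by (simp add: p_def h_def)
qed

section \<open>Infeasible almost stationary points and nearby subgradients\<close>

lemma dir_sector_mono: "\<eta> \<le> \<eta>' \<Longrightarrow> dir_sector \<eta> u \<subseteq> dir_sector \<eta>' u"
  unfolding dir_sector_def by force

text \<open>The minimiser \<open>w\<close> of \<open>g y + c * norm (y - z)\<close> satisfies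
  \<open>g y \<ge> g w - c * norm (y - w)\<close> nearby. Inserting the upper expansion of the norm
  of the positive part turns this into a lower bound on its linear term. Half of \<open>e\<close> is
  the penalty slope \<open>c\<close>, the other half absorbs the quadratic remainder.\<close>

lemma almost_stationary_multiplier:
  fixes \<phi> :: "'a::euclidean_space \<Rightarrow> real ^ 'q"
  assumes lip: "L-lipschitz_on ((+) x ` dir_sector \<eta> u) \<phi>" and "\<eta> > 0" "\<phi> x \<le> 0"
    and not_MSCQ: "\<not> dir_MSCQ \<phi> x u" and "e > 0"
  obtains t v \<rho> where "0 < t" "t < e" "dist v u < e" "\<rho> > 0" "pos_part_vec (\<phi> (x + t *\<^sub>R v)) \<noteq> 0"
    "\<And>z. z \<in> cball (x + t *\<^sub>R v) \<rho> \<Longrightarrow>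
       - e * norm (z - (x + t *\<^sub>R v))
         \<le> sgn (pos_part_vec (\<phi> (x + t *\<^sub>R v))) \<bullet> (\<phi> z - \<phi> (x + t *\<^sub>R v))"
proof -
  define S where "S = {x. \<phi> x \<le> 0}"
  define g where "g z = norm (pos_part_vec (\<phi> z))" for z
  define m where "m = min 1 (min \<eta> e)"
  \<comment> \<open>The ball around \<open>z\<close> has radius \<open>r = \<sigma> * d\<close>.
    This \<open>\<sigma>\<close> gives \<open>r \<le> t * m / 4\<close>, so the ball stays in the
    sector of size \<open>m\<close>, and \<open>\<sigma> < 1\<close> keeps it away from the feasible
    set.\<close>
  define \<sigma> where "\<sigma> = m / (4 * (norm u + 1))"
  define c where "c = e / 2"
  have b: "norm u + 1 > 0" by (simp add: add_nonneg_pos)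
  have m: "0 < m" "m \<le> 1" "m \<le> \<eta>" "m \<le> e" using assms by (auto simp: m_def)
  have \<sigma>: "\<sigma> > 0" "\<sigma> * (norm u + 1) = m / 4" using m b by (simp_all add: \<sigma>_def divide_simps)
  have "\<sigma> \<le> \<sigma> * (norm u + 1)" using \<sigma>(1) by simp
  then have \<sigma>1: "\<sigma> < 1" using \<sigma> m by simp
  have c: "c > 0" using assms by (simp add: c_def)
  obtain \<epsilon> \<delta> where "\<epsilon> > 0" "\<delta> > 0" and nbhd: "dir_nbhd \<epsilon> \<delta> u \<subseteq> insert 0 (dir_sector (m / 2) u)"
    using dir_nbhd_subset_dir_sector[of "m / 2" u] m by auto
  moreover have "1 / (c * \<sigma>) > 0" using c \<sigma> by simp
  ultimately have "\<not> (\<forall>z \<in> (+) x ` dir_nbhd \<epsilon> \<delta> u. infdist z S \<le> 1 / (c * \<sigma>) * g z)"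
    using not_MSCQ unfolding dir_MSCQ_def S_def g_def by blast
  then obtain z0 where z0: "z0 \<in> dir_nbhd \<epsilon> \<delta> u" "infdist (x + z0) S > 1 / (c * \<sigma>) * g (x + z0)"
    by (auto simp: not_le)
  have xS: "x \<in> S" using assms by (simp add: S_def)
  \<comment> \<open>The apex corresponds to the feasible point \<open>x\<close>, where the distance
    is zero; every other point of the neighbourhood lies in the sector.\<close>
  have "z0 \<noteq> 0"
  proof
    assume "z0 = 0"
    then have "infdist (x + z0) S = 0" using xS by simp
    moreover have "1 / (c * \<sigma>) * g (x + z0) \<ge> 0" using c \<sigma> by (simp add: g_def)
    ultimately show False using z0 by linarith
  qed
  then obtain t v where t: "0 < t" "t < m / 2" and v: "dist v u < m / 2" and z0_eq: "z0 = t *\<^sub>R v"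
    using z0(1) nbhd unfolding dir_sector_def by blast
  define z where "z = x + t *\<^sub>R v"
  define d where "d = infdist z S"
  define r where "r = \<sigma> * d"
  have gz: "g z < c * r"
    using z0(2) c \<sigma> by (simp add: z_def d_def r_def z0_eq field_simps)
  moreover have "g z \<ge> 0" by (simp add: g_def)
  ultimately have "c * r > 0" by linarith
  then have r: "r > 0" and d: "d > 0" using c \<sigma> by (auto simp: r_def zero_less_mult_iff)
  have "norm v \<le> norm u + 1"
    using v m norm_triangle_ineq2[of v u] by (simp add: dist_norm)
  \<comment> \<open>Feasibility of \<open>x\<close> makes \<open>d\<close> at most of order
    \<open>t\<close>, so the ball is small relative to the distance from the apex.\<close>
  moreover have "d \<le> dist z x" unfolding d_def using xS by (rule infdist_le)
  then have "d \<le> t * norm v" using t by (simp add: z_def dist_norm)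
  ultimately have "d \<le> t * (norm u + 1)" using t by (meson less_imp_le mult_left_mono order_trans)
  then have "r \<le> \<sigma> * (t * (norm u + 1))" unfolding r_def using \<sigma> by simp
  also have "\<dots> = t * (m / 4)" using \<sigma>(2) by (metis mult.left_commute)
  finally have "r / t \<le> m / 4" using t by (simp add: pos_divide_le_eq mult.commute)
  then have "dist v u + r / t < m" using v m by linarith
  then have sector: "cball z r \<subseteq> (+) x ` dir_sector m u"
    unfolding z_def using t m by (intro cball_subset_dir_sector) linarith+
  also have sector': "\<dots> \<subseteq> (+) x ` dir_sector \<eta> u"
    using dir_sector_mono[OF m(3)] by blast
  finally have lip_r: "L-lipschitz_on (cball z r) \<phi>" by (rule lipschitz_on_subset[OF lip])
  then have L: "L \<ge> 0" by (rule lipschitz_on_nonneg)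
  have "continuous_on (cball z r) (\<lambda>y. g y + c * norm (y - z))"
    unfolding g_def
    by (intro continuous_intros lipschitz_on_continuous_on[OF lip_r])
  with r have "\<exists>w\<in>cball z r. \<forall>y\<in>cball z r. g w + c * norm (w - z) \<le> g y + c * norm (y - z)"
    by (intro continuous_attains_inf) auto
  then obtain w where w: "w \<in> cball z r"
    and w_min: "\<And>y. y \<in> cball z r \<Longrightarrow> g w + c * norm (w - z) \<le> g y + c * norm (y - z)"
    by blast
  \<comment> \<open>Comparison with the centre \<open>z\<close>, where the penalty vanishes and
    \<open>g z < c * r\<close>, shows that \<open>w\<close> is interior.\<close>
  have "c * norm (w - z) < c * r"
    using w_min[of z] gz r by (simp add: g_def) (smt (verit) norm_ge_zero)
  then have wr: "norm (w - z) < r" using c by simp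
  have "w \<notin> S"
  proof
    assume "w \<in> S"
    then have "d \<le> norm (w - z)" unfolding d_def by (metis infdist_le dist_norm dist_commute)
    moreover have "r < d" using d \<sigma>1 by (simp add: r_def)
    ultimately show False using wr by simp
  qed
  then have p: "pos_part_vec (\<phi> w) \<noteq> 0" by (simp add: S_def pos_part_vec_eq_0_iff)
  then have gw: "g w > 0" by (simp add: g_def)
  \<comment> \<open>The first entry keeps the ball around \<open>w\<close> inside
    \<open>cball z r\<close>; the second makes the quadratic remainder at most
    \<open>c * norm (y - w)\<close>. Adding \<open>1\<close> covers \<open>L = 0\<close>.\<close>
  define \<rho> where "\<rho> = min (r - norm (w - z)) (2 * g w * c / (L\<^sup>2 + 1))"
  have L1: "L\<^sup>2 + 1 > 0" by (simp add: add_nonneg_pos)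
  then have \<rho>: "\<rho> > 0" using wr gw c by (simp add: \<rho>_def)
  have "\<rho> * (L\<^sup>2 + 1) \<le> 2 * g w * c"
    using L1 by (subst pos_le_divide_eq[symmetric]) (auto simp: \<rho>_def)
  then have \<rho>L: "L\<^sup>2 * \<rho> \<le> 2 * g w * c" using \<rho> by (simp add: algebra_simps)
  have main: "- e * norm (y - w) \<le> sgn (pos_part_vec (\<phi> w)) \<bullet> (\<phi> y - \<phi> w)" if "y \<in> cball w \<rho>" for y
  proof -
    have yw: "norm (y - w) \<le> \<rho>" using that by (simp add: dist_norm norm_minus_commute)
    have y: "y \<in> cball z r"
      using yw norm_triangle_ineq[of "y - w" "w - z"]
      by (simp add: \<rho>_def dist_norm norm_minus_commute)
    have "c * norm (y - z) \<le> c * (norm (y - w) + norm (w - z))"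
      using c norm_triangle_ineq[of "y - w" "w - z"] by simp
    then have 1: "g y \<ge> g w - c * norm (y - w)"
      using w_min[OF y] by (simp add: algebra_simps)
    have "norm (\<phi> y - \<phi> w) \<le> L * norm (y - w)"
      using lipschitz_onD[OF lip_r y w] by (simp add: dist_norm)
    then have "(norm (\<phi> y - \<phi> w))\<^sup>2 \<le> (L * norm (y - w))\<^sup>2" by (simp add: power_mono)
    also have "\<dots> = L\<^sup>2 * norm (y - w) * norm (y - w)" by (simp add: power2_eq_square)
    also have "\<dots> \<le> L\<^sup>2 * \<rho> * norm (y - w)"
      using yw by (intro mult_right_mono mult_left_mono) auto
    also have "\<dots> \<le> 2 * g w * c * norm (y - w)"
      using \<rho>L by (intro mult_right_mono) auto
    finally have "(norm (\<phi> y - \<phi> w))\<^sup>2 / (2 * g w) \<le> c * norm (y - w)"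
      using gw by (simp add: field_simps)
    then show ?thesis
      using 1 norm_pos_part_vec_upper_expansion[OF p, of "\<phi> y"] by (simp add: g_def c_def)
  qed
  obtain t' v' where "0 < t'" "t' < m" "dist v' u < m" "w = x + t' *\<^sub>R v'"
    using subsetD[OF sector w] unfolding dir_sector_def by blast
  then show ?thesis
    using that[of t' v' \<rho>] m(4) \<rho> p main by simp
qed

text \<open>The limiting subdifferential concerns one fixed scalar function, whereas the multipliers
  vary with the point. By Cauchy-Schwarz, replacing \<open>\<zeta>\<close> by
  \<open>\<zeta>'\<close> raises the slope by at most \<open>L * dist \<zeta> \<zeta>'\<close>; the
  quadratic penalisation then applies.\<close>

lemma almost_stationary_imp_regular_subgradient:
  fixes \<phi> :: "'a::euclidean_space \<Rightarrow> 'b::real_inner"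
  assumes lip: "L-lipschitz_on ((+) x ` dir_sector e u) \<phi>" and "e > 0" "\<rho> > 0"
    and tv: "0 < t" "t < e" "dist v u < e"
    and stat: "\<And>z. z \<in> cball (x + t *\<^sub>R v) \<rho> \<Longrightarrow>
       - e * norm (z - (x + t *\<^sub>R v)) \<le> \<zeta> \<bullet> (\<phi> z - \<phi> (x + t *\<^sub>R v))"
  obtains t' v' \<xi> where "0 < t'" "t' < e" "dist v' u < e" "norm \<xi> \<le> 2 * (e + L * dist \<zeta> \<zeta>')"
    "\<xi> \<in> regular_subdiff (\<lambda>z. \<zeta>' \<bullet> \<phi> z) (x + t' *\<^sub>R v')"
proof -
  define w where "w = x + t *\<^sub>R v"
  \<comment> \<open>Half of the remaining slack in the direction is used, so that the whole ball
    stays in the sector.\<close>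
  define \<rho>' where "\<rho>' = min \<rho> (t * (e - dist v u) / 2)"
  have \<rho>': "\<rho>' > 0" "\<rho>' \<le> \<rho>" using assms by (auto simp: \<rho>'_def)
  have "\<rho>' / t \<le> (e - dist v u) / 2" using tv by (simp add: \<rho>'_def pos_divide_le_eq mult.commute)
  also have "\<dots> < e - dist v u" using tv by simp
  finally have "dist v u + \<rho>' / t < e" by (metis less_diff_eq add.commute)
  then have sector: "cball w \<rho>' \<subseteq> (+) x ` dir_sector e u"
    unfolding w_def using tv by (intro cball_subset_dir_sector) simp_all
  have lip': "L-lipschitz_on (cball w \<rho>') \<phi>" by (rule lipschitz_on_subset[OF lip sector])
  have L: "L \<ge> 0" using lip by (rule lipschitz_on_nonneg)
  have "\<zeta>' \<bullet> \<phi> z \<ge> \<zeta>' \<bullet> \<phi> w - (e + L * dist \<zeta> \<zeta>') * norm (z - w)" if z: "z \<in> cball w \<rho>'" for z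
  proof -
    have "norm (\<phi> z - \<phi> w) \<le> L * norm (z - w)"
      using lipschitz_onD[OF lip' z, of w] \<rho>' by (simp add: dist_norm)
    then have "norm (\<zeta> - \<zeta>') * norm (\<phi> z - \<phi> w) \<le> norm (\<zeta> - \<zeta>') * (L * norm (z - w))"
      by (intro mult_left_mono) auto
    moreover have "(\<zeta> - \<zeta>') \<bullet> (\<phi> z - \<phi> w) \<le> norm (\<zeta> - \<zeta>') * norm (\<phi> z - \<phi> w)"
      by (rule norm_cauchy_schwarz)
    moreover have "- e * norm (z - w) \<le> \<zeta> \<bullet> (\<phi> z - \<phi> w)"
      using stat[of z] z \<rho>' by (simp add: w_def)
    ultimately show ?thesis by (simp add: dist_norm algebra_simps)
  qed
  moreover have "continuous_on (cball w \<rho>') (\<lambda>z. \<zeta>' \<bullet> \<phi> z)"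
    by (intro continuous_intros lipschitz_on_continuous_on[OF lip'])
  moreover have "e + L * dist \<zeta> \<zeta>' > 0" using L assms(2) by (simp add: add_pos_nonneg)
  ultimately obtain w' \<xi> where w': "dist w w' < \<rho>'" "norm \<xi> \<le> 2 * (e + L * dist \<zeta> \<zeta>')"
    "\<xi> \<in> regular_subdiff (\<lambda>z. \<zeta>' \<bullet> \<phi> z) w'"
    using regular_subgradient_near_almost_min[OF \<rho>'(1), of "e + L * dist \<zeta> \<zeta>'" w "\<lambda>z. \<zeta>' \<bullet> \<phi> z"]
    by blast
  then have "w' \<in> (+) x ` dir_sector e u" using sector by auto
  with w' that show ?thesis unfolding dir_sector_def by blast
qed

lemma lipschitz_on_sector_tendsto:
  assumes lip: "L-lipschitz_on (insert x ((+) x ` dir_sector \<eta> u)) \<phi>" and "\<eta> > 0"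
    and t: "\<And>k. t k > 0" "t \<longlonglongrightarrow> 0" and us: "us \<longlonglongrightarrow> u"
  shows "(\<lambda>k. \<phi> (x + t k *\<^sub>R us k)) \<longlonglongrightarrow> \<phi> x"
proof -
  have "(\<lambda>k. x + t k *\<^sub>R us k) \<longlonglongrightarrow> x + 0 *\<^sub>R u" by (intro tendsto_intros t us)
  then have "(\<lambda>k. x + t k *\<^sub>R us k) \<longlonglongrightarrow> x" by simp
  moreover have "\<forall>\<^sub>F k in sequentially. x + t k *\<^sub>R us k \<in> insert x ((+) x ` dir_sector \<eta> u)"
    using dir_sequence_eventually_in_sector[OF \<open>\<eta> > 0\<close> t us, of x] by eventually_elim simp
  ultimately show ?thesis
    using continuous_on_tendsto_compose[OF lipschitz_on_continuous_on[OF lip]] by blast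
qed

section \<open>Limit multiplier and contradiction with quasi-normality\<close>

theorem proposition3p1:
  fixes \<phi> :: "real ^ 'n \<Rightarrow> real ^ 'q" and zbar u :: "real ^ 'n"
  assumes "\<phi> zbar \<le> 0"
    and "u \<in> linearized_cone \<phi> zbar"
    and "dir_lipschitz \<phi> zbar u"
    and "dir_differentiable \<phi> zbar u"
    and "dir_quasi_normality \<phi> zbar u"
  shows "dir_MSCQ \<phi> zbar u"
proof (rule ccontr)
  assume not_MSCQ: "\<not> dir_MSCQ \<phi> zbar u"
  obtain L \<eta> where \<eta>: "\<eta> > 0" and lip: "L-lipschitz_on (insert zbar ((+) zbar ` dir_sector \<eta> u)) \<phi>"
    using dir_lipschitz_imp_lipschitz_on_sector assms(3) by blast
  have lip': "L-lipschitz_on ((+) zbar ` dir_sector \<eta> u) \<phi>"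
    using lip by (rule lipschitz_on_subset) blast
  \<comment> \<open>The sequence starts at \<open>\<eta>\<close> and never exceeds it, so every
    sector of size \<open>e k\<close> lies where \<open>\<phi>\<close> is Lipschitz.\<close>
  define e where "e k = \<eta> * inverse (real (Suc k))" for k
  have e: "e k > 0" "e k \<le> \<eta>" for k using \<eta> by (auto simp: e_def field_simps)
  have e_lim: "e \<longlonglongrightarrow> 0"
    unfolding e_def by (intro tendsto_mult_right_zero LIMSEQ_inverse_real_of_nat)
  have "\<forall>k. \<exists>t v \<rho>. 0 < t \<and> t < e k \<and> dist v u < e k \<and> \<rho> > 0 \<and>
      pos_part_vec (\<phi> (zbar + t *\<^sub>R v)) \<noteq> 0 \<and>
      (\<forall>z \<in> cball (zbar + t *\<^sub>R v) \<rho>. - e k * norm (z - (zbar + t *\<^sub>R v))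
         \<le> sgn (pos_part_vec (\<phi> (zbar + t *\<^sub>R v))) \<bullet> (\<phi> z - \<phi> (zbar + t *\<^sub>R v)))"
    using almost_stationary_multiplier[OF lip' \<eta> assms(1) not_MSCQ e(1)] by metis
  then obtain t v \<rho> where t: "\<And>k. 0 < t k" "\<And>k. t k < e k" and v: "\<And>k. dist (v k) u < e k"
    and \<rho>: "\<And>k. \<rho> k > 0" and p: "\<And>k. pos_part_vec (\<phi> (zbar + t k *\<^sub>R v k)) \<noteq> 0"
    and stat: "\<And>k z. z \<in> cball (zbar + t k *\<^sub>R v k) (\<rho> k) \<Longrightarrow>
       - e k * norm (z - (zbar + t k *\<^sub>R v k))
         \<le> sgn (pos_part_vec (\<phi> (zbar + t k *\<^sub>R v k))) \<bullet> (\<phi> z - \<phi> (zbar + t k *\<^sub>R v k))"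
    by metis
  define \<zeta>s where "\<zeta>s k = sgn (pos_part_vec (\<phi> (zbar + t k *\<^sub>R v k)))" for k
  have "\<forall>k. \<zeta>s k \<in> sphere 0 1" using p by (simp add: \<zeta>s_def norm_sgn)
  then obtain \<zeta> s where \<zeta>: "\<zeta> \<in> sphere 0 1" and s: "strict_mono s" and "(\<zeta>s \<circ> s) \<longlonglongrightarrow> \<zeta>"
    using compact_sphere[of "0 :: real ^ 'q" 1] unfolding compact_eq_seq_compact_metric seq_compact_def by metis
  then have \<zeta>_lim: "(\<lambda>k. \<zeta>s (s k)) \<longlonglongrightarrow> \<zeta>" by (simp add: comp_def)
  have es_lim: "(\<lambda>k. e (s k)) \<longlonglongrightarrow> 0"
    using LIMSEQ_subseq_LIMSEQ[OF e_lim s] by (simp add: comp_def)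
  have squeeze: "a \<longlonglongrightarrow> 0 \<and> b \<longlonglongrightarrow> u"
    if "\<And>k. 0 < a k" "\<And>k. a k < e (s k)" "\<And>k. dist (b k) u < e (s k)" for a b
  proof
    show "a \<longlonglongrightarrow> 0"
      by (rule tendsto_sandwich[OF _ _ tendsto_const es_lim]) (auto intro!: always_eventually less_imp_le that)
    show "b \<longlonglongrightarrow> u"
      by (rule iffD2[OF tendsto_dist_iff], rule tendsto_sandwich[OF _ _ tendsto_const es_lim])
        (auto intro!: always_eventually less_imp_le that)
  qed
  have ts: "(\<lambda>k. t (s k)) \<longlonglongrightarrow> 0" and vs: "(\<lambda>k. v (s k)) \<longlonglongrightarrow> u"
    using squeeze[of "\<lambda>k. t (s k)" "\<lambda>k. v (s k)"] t v by auto

  \<comment> \<open>A positive component of the limit is eventually positive in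
    \<open>\<zeta>s (s k)\<close>, a positive multiple of the positive part, so the constraint
    itself is violated there.\<close>
  have pos: "\<forall>\<^sub>F k in sequentially. \<phi> (zbar + t (s k) *\<^sub>R v (s k)) $ j > 0" if "\<zeta> $ j > 0" for j
  proof -
    have "\<forall>\<^sub>F k in sequentially. \<zeta>s (s k) $ j > 0"
      using order_tendstoD(1)[OF tendsto_vec_nth[OF \<zeta>_lim] that] .
    then show ?thesis
      by eventually_elim
        (auto simp: \<zeta>s_def sgn_div_norm pos_part_vec_def zero_less_mult_iff zero_less_divide_iff)
  qed
  have active: "\<phi> zbar $ j = 0" if "\<zeta> $ j > 0" for j
  proof -
    have "(\<lambda>k. \<phi> (zbar + t (s k) *\<^sub>R v (s k)) $ j) \<longlonglongrightarrow> \<phi> zbar $ j"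
      by (intro tendsto_vec_nth lipschitz_on_sector_tendsto[OF lip \<eta>] t ts vs)
    then have "\<phi> zbar $ j \<ge> 0"
      by (rule tendsto_lowerbound) (use pos[OF that] in \<open>auto elim: eventually_mono\<close>)
    then show ?thesis using assms(1) by (simp add: less_eq_vec_def order_antisym)
  qed
  have deriv: "dir_deriv \<phi> zbar u $ j = 0" if "\<zeta> $ j > 0" for j
  proof -
    \<comment> \<open>The linearized cone speaks of derivatives of components, quasi-normality of
      the vector derivative. The cone gives \<open>\<le> 0\<close>; quotients of violated active
      constraints give \<open>\<ge> 0\<close>.\<close>
    have "dir_deriv (\<lambda>z. \<phi> z $ j) zbar u = dir_deriv \<phi> zbar u $ j"
      using tendsto_vec_nth[OF dir_deriv_tendsto[OF assms(4)], of j] unfolding dir_deriv_def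
      by (intro tendsto_Lim) auto
    then have "dir_deriv \<phi> zbar u $ j \<le> 0"
      using assms(2) active[OF that] unfolding linearized_cone_def active_set_def by auto
    moreover have "(\<lambda>k. ((\<phi> (zbar + t (s k) *\<^sub>R v (s k)) - \<phi> zbar) /\<^sub>R t (s k)) $ j)
        \<longlonglongrightarrow> dir_deriv \<phi> zbar u $ j"
      by (intro tendsto_vec_nth dir_deriv_Hadamard[OF lip \<eta> assms(4)] t ts vs)
    then have "dir_deriv \<phi> zbar u $ j \<ge> 0"
    proof (rule tendsto_lowerbound)
      show "\<forall>\<^sub>F k in sequentially. 0 \<le> ((\<phi> (zbar + t (s k) *\<^sub>R v (s k)) - \<phi> zbar) /\<^sub>R t (s k)) $ j"
        using pos[OF that] by eventually_elim (use t active[OF that] in \<open>simp add: less_imp_le\<close>)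
    qed simp
    ultimately show ?thesis by simp
  qed
  have \<zeta>_nonneg: "\<zeta> $ j \<ge> 0" for j
    using tendsto_vec_nth[OF \<zeta>_lim, of j]
    by (rule tendsto_lowerbound)
      (auto simp: \<zeta>s_def sgn_div_norm pos_part_vec_def intro!: always_eventually)
  have \<zeta>_cases: "\<zeta> $ j = 0 \<or> \<zeta> $ j > 0" for j using \<zeta>_nonneg[of j] by linarith

  \<comment> \<open>The subgradients live at new points \<open>t' k\<close>, \<open>v' k\<close>;
    quasi-normality allows these to differ from the points where the constraints are
    violated.\<close>
  have "\<forall>k. \<exists>t' v' \<xi>. 0 < t' \<and> t' < e (s k) \<and> dist v' u < e (s k) \<and>
      norm \<xi> \<le> 2 * (e (s k) + L * dist (\<zeta>s (s k)) \<zeta>) \<and>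
      \<xi> \<in> regular_subdiff (\<lambda>z. \<zeta> \<bullet> \<phi> z) (zbar + t' *\<^sub>R v')"
  proof
    fix k
    have "L-lipschitz_on ((+) zbar ` dir_sector (e (s k)) u) \<phi>"
      using dir_sector_mono[OF e(2)] by (intro lipschitz_on_subset[OF lip'] image_mono)
    from almost_stationary_imp_regular_subgradient[OF this e(1) \<rho> t v stat, of "s k"]
    show "\<exists>t' v' \<xi>. 0 < t' \<and> t' < e (s k) \<and> dist v' u < e (s k) \<and>
      norm \<xi> \<le> 2 * (e (s k) + L * dist (\<zeta>s (s k)) \<zeta>) \<and>
      \<xi> \<in> regular_subdiff (\<lambda>z. \<zeta> \<bullet> \<phi> z) (zbar + t' *\<^sub>R v')"
      unfolding \<zeta>s_def by metis
  qed
  then obtain t' v' \<xi> where t': "\<And>k. 0 < t' k" "\<And>k. t' k < e (s k)"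
    and v': "\<And>k. dist (v' k) u < e (s k)"
    and \<xi>: "\<And>k. norm (\<xi> k) \<le> 2 * (e (s k) + L * dist (\<zeta>s (s k)) \<zeta>)"
      "\<And>k. \<xi> k \<in> regular_subdiff (\<lambda>z. \<zeta> \<bullet> \<phi> z) (zbar + t' k *\<^sub>R v' k)"
    by metis
  have tv'_lim: "t' \<longlonglongrightarrow> 0" "v' \<longlonglongrightarrow> u" using squeeze t' v' by auto
  have "(\<lambda>k. 2 * (e (s k) + L * dist (\<zeta>s (s k)) \<zeta>)) \<longlonglongrightarrow> 2 * (0 + L * dist \<zeta> \<zeta>)"
    by (intro tendsto_intros es_lim \<zeta>_lim)
  then have "\<xi> \<longlonglongrightarrow> 0"
    using \<xi>(1) by (intro Lim_null_comparison[of \<xi>]) auto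
  moreover have "(\<lambda>k. \<zeta> \<bullet> \<phi> (zbar + t' k *\<^sub>R v' k)) \<longlonglongrightarrow> \<zeta> \<bullet> \<phi> zbar"
    by (intro tendsto_intros lipschitz_on_sector_tendsto[OF lip \<eta>] t' tv'_lim)
  ultimately have subdiff: "0 \<in> dir_limiting_subdiff (\<lambda>z. \<zeta> \<bullet> \<phi> z) zbar u"
    unfolding dir_limiting_subdiff_def using t' tv'_lim \<xi>(2) by blast

  \<comment> \<open>There are finitely many components, so one \<open>N\<close> serves all; the
    shift by \<open>N\<close> gives positivity for every \<open>k\<close>, as quasi-normality
    demands.\<close>
  have "\<forall>\<^sub>F k in sequentially. \<forall>j. \<zeta> $ j > 0 \<longrightarrow> \<phi> (zbar + t (s k) *\<^sub>R v (s k)) $ j > 0"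
    using pos by (intro eventually_all_finite) (auto simp: eventually_mono)
  then obtain N where N: "\<And>k j. k \<ge> N \<Longrightarrow> \<zeta> $ j > 0 \<Longrightarrow> \<phi> (zbar + t (s k) *\<^sub>R v (s k)) $ j > 0"
    unfolding eventually_sequentially by blast
  have "\<exists>(a :: nat \<Rightarrow> real) us. (\<forall>k. a k > 0) \<and> a \<longlonglongrightarrow> 0 \<and> us \<longlonglongrightarrow> u \<and>
      (\<forall>j \<in> active_set \<phi> zbar. \<zeta> $ j > 0 \<longrightarrow> (\<forall>k. \<phi> (zbar + a k *\<^sub>R us k) $ j > 0))"
    by (rule exI[of _ "\<lambda>k. t (s (k + N))"], rule exI[of _ "\<lambda>k. v (s (k + N))"])
      (use N t LIMSEQ_ignore_initial_segment[OF ts, of N] LIMSEQ_ignore_initial_segment[OF vs, of N] in auto)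
  moreover have "\<zeta> \<noteq> 0" using \<zeta> by auto
  moreover have "\<zeta> \<ge> 0" using \<zeta>_nonneg by (simp add: less_eq_vec_def)
  moreover have "orthogonal \<zeta> (\<phi> zbar)"
    unfolding orthogonal_def inner_vec_def using \<zeta>_cases active
    by (intro sum.neutral) (metis inner_zero_left inner_zero_right)
  moreover have "orthogonal \<zeta> (dir_deriv \<phi> zbar u)"
    unfolding orthogonal_def inner_vec_def using \<zeta>_cases deriv
    by (intro sum.neutral) (metis inner_zero_left inner_zero_right)
  ultimately show False
    using assms(5) subdiff unfolding dir_quasi_normality_def by blast
qed

end
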